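(* Let $G=(V,E,\mathbf w)$ be a weighted undirected graph and let $R_i$ be the residuals of the UGA for graph sparsification described in the context. Then for all $i\ge1$, $$\|R_{i+1}\|_F^2\le\frac{\|L_G\|_F^2}{1+i\|L_G\|_F^2/(\mathrm{Tr}(L_G))^2},$$ where $\mathrm{Tr}$ denotes the trace.
   Context: $\mathbf e_u$ are standard basis vectors, $\phi_{(u,v)}=(\mathbf e_u-\mathbf e_v)(\mathbf e_u-\mathbf e_v)^\top$, $L_G=\sum_{(u,v)\in E}w_{(u,v)}\phi_{(u,v)}$ with $w_{(u,v)}>0$; $\langle X,Y\rangle=\mathrm{tr}(X^\top Y)$ and $\|\cdot\|_F$ the Frobenius norm. The UGA for graph sparsification: $R_0=L_G$, $L_{H_0}=0$; for $i=1,2,\dots$: choose $(u_i,v_i)\in E$ maximizing $|\langle\phi_{(u,v)},R_{i-1}\rangle|$ over $(u,v)\in E$; compute $(\alpha_1^i,\alpha_2^i)\in\arg\min_{(\alpha_1,\alpha_2)\in\mathbb R^2}\|L_G-\alpha_1L_{H_{i-1}}-\alpha_2\phi_{(u_i,v_i)}\|_F^2$; set $L_{H_i}=\alpha_1^iL_{H_{i-1}}+\alpha_2^i\phi_{(u_i,v_i)}$ and $R_i=L_G-L_{H_i}$. *)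

theory Defs
  imports "HOL-Analysis.Analysis" "HOL-Library.Uprod"
begin

definition frob_inner :: "real^'n^'n \<Rightarrow> real^'n^'n \<Rightarrow> real" where
  "frob_inner X Y = trace (transpose X ** Y)"

definition frob_norm :: "real^'n^'n \<Rightarrow> real" where
  "frob_norm X = sqrt (frob_inner X X)"

lemma frob_inner_eq_inner: "frob_inner X Y = X \<bullet> Y"
proof -
  have "frob_inner X Y = (\<Sum>i\<in>UNIV. \<Sum>k\<in>UNIV. X $ k $ i * Y $ k $ i)"
    by (simp add: frob_inner_def trace_def transpose_def matrix_matrix_mult_def)
  also have "\<dots> = (\<Sum>k\<in>UNIV. \<Sum>i\<in>UNIV. X $ k $ i * Y $ k $ i)"
    by (rule sum.swap)
  finally show ?thesis
    by (simp add: inner_vec_def)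
qed

lemma frob_norm_eq_norm: "frob_norm X = norm X"
  by (simp add: frob_norm_def frob_inner_eq_inner norm_eq_sqrt_inner)

definition outer :: "real^'n \<Rightarrow> real^'n \<Rightarrow> real^'n^'n" where
  "outer x y = (columnvector x :: real^1^'n) ** rowvector y"

lemma outer_nth: "outer x y $ i $ j = x $ i * y $ j"
  by (simp add: outer_def columnvector_def rowvector_def matrix_matrix_mult_def)

text \<open>
  The vertex set is the finite index type 'n. Edges are unordered pairs, so each
  undirected edge occurs once in sums and maximizations over the edge set; the matrix
  of an edge does not depend on how its endpoints are ordered. Loops are
  not excluded: their matrix is zero.
\<close>

lift_definition edge_mat :: "'n uprod \<Rightarrow> real^'n^'n" is
  "\<lambda>(u, v). outer (axis u 1 - axis v 1) (axis u 1 - axis v 1)"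
  by (auto simp: vec_eq_iff outer_nth algebra_simps)

lemma edge_mat_Upair:
  "edge_mat (Upair u v) = outer (axis u 1 - axis v 1) (axis u 1 - axis v 1)"
  by transfer simp

lemma finite_edges: "finite (E :: 'n::finite uprod set)"
  by (rule finite_subset[OF subset_UNIV]) simp

definition laplacian :: "'n uprod set \<Rightarrow> ('n uprod \<Rightarrow> real) \<Rightarrow> real^'n^'n" where
  "laplacian E w = (\<Sum>e\<in>E. w e *\<^sub>R edge_mat e)"

text \<open>
  Neither the maximizing edge nor the pair of coefficients need be unique (the latter
  never is in the first step, where the previous iterate is 0), so a run of the
  algorithm is a relation. H i is the approximation written as the Laplacian of H_i,
  R i the residual, e i the selected edge and a i the pair of coefficients of step i;
  e and a are irrelevant at index 0.
\<close>

definition uga_run ::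
  "'n uprod set \<Rightarrow> ('n uprod \<Rightarrow> real) \<Rightarrow> (nat \<Rightarrow> 'n uprod) \<Rightarrow> (nat \<Rightarrow> real \<times> real) \<Rightarrow>
    (nat \<Rightarrow> real^'n^'n) \<Rightarrow> (nat \<Rightarrow> real^'n^'n) \<Rightarrow> bool" where
  "uga_run E w e a H R \<longleftrightarrow>
     R 0 = laplacian E w \<and> H 0 = 0 \<and>
     (\<forall>i\<ge>1.
        is_arg_max (\<lambda>f. \<bar>frob_inner (edge_mat f) (R (i - 1))\<bar>) (\<lambda>f. f \<in> E) (e i) \<and>
        is_arg_min
          (\<lambda>(a1, a2). (frob_norm (laplacian E w - a1 *\<^sub>R H (i - 1) - a2 *\<^sub>R edge_mat (e i)))\<^sup>2)
          (\<lambda>_. True) (a i) \<and>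
        H i = fst (a i) *\<^sub>R H (i - 1) + snd (a i) *\<^sub>R edge_mat (e i) \<and>
        R i = laplacian E w - H i)"

end

theory Submission
  imports Defs
begin

text \<open>
  Rescaling the optimal coefficients shows that every residual \<open>R\<close> is orthogonal to the current
  approximation, so \<open>\<parallel>R\<parallel>\<^sup>2 = \<langle>L, R\<rangle> = \<Sum>f. w f * \<langle>\<phi> f, R\<rangle> \<le> (Tr L / 2) * M\<close>, where \<open>M\<close> is the largest
  correlation \<open>\<bar>\<langle>\<phi> f, R\<rangle>\<bar>\<close>. Since \<open>\<parallel>\<phi>\<parallel> = 2\<close> for a non-loop, a step along the selected edge alone
  already decreases \<open>\<parallel>R\<parallel>\<^sup>2\<close> by \<open>M\<^sup>2 / 4\<close>. Hence \<open>r i = \<parallel>R i\<parallel>\<^sup>2\<close> satisfies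
  \<open>r (i + 1) \<le> r i - (r i)\<^sup>2 / (Tr L)\<^sup>2\<close>, that is, \<open>1 / r\<close> grows by at least \<open>1 / (Tr L)\<^sup>2\<close> per step.
\<close>

lemma sublinear_decay:
  fixes r :: "nat \<Rightarrow> real"
  assumes nonneg: "\<And>i. 0 \<le> r i" and "0 \<le> c"
    and step: "\<And>i. (r i)\<^sup>2 \<le> c * (r i - r (Suc i))"
  shows "r i \<le> r 0 / (1 + real i * r 0 / c)"
proof (cases "c = 0")
  case True
  \<comment> \<open>Here \<open>step\<close> forces \<open>r i = 0\<close> and
    \<open>r 0 = 0\<close>; the bound reads \<open>0 \<le> 0\<close>, as division by zero yields
    0.\<close>
  then show ?thesis using step[of i] step[of 0] by simp
next
  case False
  with \<open>0 \<le> c\<close> have c: "0 < c" by simp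
  \<comment> \<open>This is \<open>1 / r i \<ge> 1 / r 0 + i / c\<close> with denominators cleared,
    so it still makes sense once \<open>r\<close> vanishes.\<close>
  have "(c + real i * r 0) * r i \<le> c * r 0"
  proof (induction i)
    case 0
    show ?case by simp
  next
    case (Suc i)
    show ?case
    proof (cases "r i = 0")
      case True
      have "r (Suc i) = 0"
        using step[of i] nonneg[of "Suc i"] c True by (simp add: mult_le_0_iff)
      then show ?thesis using c nonneg[of 0] by simp
    next
      case False
      then have pos: "0 < r i" using nonneg[of i] by simp
      have "0 \<le> c * (r i - r (Suc i))"
        using step[of i] by (rule order_trans[rotated]) simp
      then have "r (Suc i) \<le> r i"
        using c by (simp add: zero_le_mult_iff)
      then have "r i * r (Suc i) \<le> (r i)\<^sup>2"
        using pos by (simp add: power2_eq_square)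
      also note step[of i]
      finally have "r 0 * (r i * r (Suc i)) \<le> r 0 * (c * (r i - r (Suc i)))"
        using nonneg[of 0] by (rule mult_left_mono)
      moreover have "(c + real i * r 0) * r i * r (Suc i) \<le> c * r 0 * r (Suc i)"
        using Suc.IH nonneg[of "Suc i"] by (rule mult_right_mono)
      \<comment> \<open>On adding the two inequalities, the terms \<open>c * r 0 * r (Suc i)\<close>
        cancel.\<close>
      ultimately have "((c + real (Suc i) * r 0) * r (Suc i)) * r i \<le> (c * r 0) * r i"
        by (simp add: algebra_simps)
      then show ?thesis using pos by simp
    qed
  qed
  moreover have "0 < c + real i * r 0"
    using c nonneg[of 0] by (simp add: add_pos_nonneg)
  ultimately have "r i \<le> c * r 0 / (c + real i * r 0)"
    by (simp add: field_simps)
  also have "\<dots> = r 0 / (1 + real i * r 0 / c)"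
    using c by (simp add: field_simps)
  finally show ?thesis .
qed

lemma power2_norm_diff_scaleR:
  fixes x y :: "'a::real_inner"
  shows "(norm (x - t *\<^sub>R y))\<^sup>2 = (norm x)\<^sup>2 - 2 * t * (y \<bullet> x) + t\<^sup>2 * (y \<bullet> y)"
  unfolding power2_norm_eq_inner
  by (simp add: inner_diff_left inner_diff_right inner_commute power2_eq_square algebra_simps)

text \<open>The squared norm is a quadratic in \<open>t\<close>; at its vertex it has dropped by
  \<open>(y \<bullet> x)\<^sup>2 / (y \<bullet> y)\<close>, which minimality at \<open>t = 0\<close>
  forces to vanish.\<close>

lemma inner_zero_if_norm_min:
  fixes x y :: "'a::real_inner"
  assumes min: "\<And>t. (norm x)\<^sup>2 \<le> (norm (x - t *\<^sub>R y))\<^sup>2"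
  shows "y \<bullet> x = 0"
proof (cases "y = 0")
  case False
  define t where "t = (y \<bullet> x) / (y \<bullet> y)"
  have "(norm (x - t *\<^sub>R y))\<^sup>2 = (norm x)\<^sup>2 - 2 * t * (y \<bullet> x) + t\<^sup>2 * (y \<bullet> y)"
    by (rule power2_norm_diff_scaleR)
  also have "\<dots> = (norm x)\<^sup>2 - (y \<bullet> x)\<^sup>2 / (y \<bullet> y)"
    using False by (simp add: t_def field_simps power2_eq_square)
  finally have "(y \<bullet> x)\<^sup>2 / (y \<bullet> y) \<le> 0"
    using min[of t] by simp
  then show ?thesis
    using False by (simp add: divide_le_0_iff inner_gt_zero_iff[symmetric] del: inner_gt_zero_iff)
qed simp

lemma inner_outer: "outer x y \<bullet> outer x' y' = (x \<bullet> x') * (y \<bullet> y')"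
  by (simp add: inner_vec_def outer_nth sum_product mult_ac)

lemma trace_outer: "trace (outer x y) = x \<bullet> y"
  by (simp add: trace_def outer_nth inner_vec_def)

lemma trace_scaleR: "trace (c *\<^sub>R A) = c * trace A"
  by (simp add: trace_def sum_distrib_left)

lemma trace_sum: "trace (\<Sum>i\<in>I. A i) = (\<Sum>i\<in>I. trace (A i))"
  by (simp add: trace_def) (rule sum.swap)

lemma edge_mat_cases:
  fixes f :: "'n::finite uprod"
  obtains "edge_mat f = 0" | "trace (edge_mat f) = 2" "edge_mat f \<bullet> edge_mat f = 4"
proof (cases f)
  case (Upair u v)
  show thesis
  proof (cases "u = v")
    case True
    then have "edge_mat f = 0"
      by (simp add: Upair edge_mat_Upair vec_eq_iff outer_nth)
    then show ?thesis by (rule that)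
  next
    case False
    define x :: "real^'n" where "x = axis u 1 - axis v 1"
    have "x \<bullet> x = 2"
      using False by (simp add: x_def inner_diff_left inner_diff_right inner_axis_axis)
    moreover have "edge_mat f = outer x x"
      by (simp add: Upair edge_mat_Upair x_def)
    ultimately show ?thesis
      by (intro that(2)) (simp_all add: trace_outer inner_outer)
  qed
qed

text \<open>Half the trace of an edge matrix is 1, or 0 for a loop, so half the trace of the
  Laplacian is the total weight of the non-loop edges, and loops contribute nothing to either
  side.\<close>

lemma inner_laplacian_le:
  assumes w: "\<And>f. f \<in> E \<Longrightarrow> 0 \<le> w f" and M: "\<And>f. f \<in> E \<Longrightarrow> \<bar>edge_mat f \<bullet> X\<bar> \<le> M"
  shows "laplacian E w \<bullet> X \<le> trace (laplacian E w) / 2 * M"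
proof -
  have "edge_mat f \<bullet> X \<le> trace (edge_mat f) / 2 * M" if "f \<in> E" for f
    using M[OF that] by (cases f rule: edge_mat_cases) (simp_all add: trace_def)
  then have "w f * (edge_mat f \<bullet> X) \<le> w f * (trace (edge_mat f) / 2 * M)" if "f \<in> E" for f
    using that w by (intro mult_left_mono)
  then have "(\<Sum>f\<in>E. w f * (edge_mat f \<bullet> X)) \<le> (\<Sum>f\<in>E. w f * (trace (edge_mat f) / 2 * M))"
    by (intro sum_mono)
  then show ?thesis
    by (simp add: laplacian_def[of E w] inner_sum_left trace_sum trace_scaleR
        sum_distrib_right sum_divide_distrib mult.assoc)
qed

context
  fixes E :: "'n::finite uprod set" and w :: "'n uprod \<Rightarrow> real"
    and e :: "nat \<Rightarrow> 'n uprod" and a :: "nat \<Rightarrow> real \<times> real"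
    and H R :: "nat \<Rightarrow> real^'n^'n"
  assumes run: "uga_run E w e a H R"
begin

lemma uga_residual: "R i = laplacian E w - H i"
  using run by (cases i) (auto simp: uga_run_def)

lemma
  shows uga_arg_max: "is_arg_max (\<lambda>f. \<bar>frob_inner (edge_mat f) (R i)\<bar>) (\<lambda>f. f \<in> E) (e (Suc i))"
    and uga_arg_min: "is_arg_min
      (\<lambda>(s, t). (frob_norm (laplacian E w - s *\<^sub>R H i - t *\<^sub>R edge_mat (e (Suc i))))\<^sup>2)
      (\<lambda>_. True) (a (Suc i))"
    and uga_approx: "H (Suc i) = fst (a (Suc i)) *\<^sub>R H i + snd (a (Suc i)) *\<^sub>R edge_mat (e (Suc i))"
proof -
  have "1 \<le> Suc i" by simp
  note step = run[unfolded uga_run_def, THEN conjunct2, THEN conjunct2, rule_format,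
      OF this, unfolded diff_Suc_1]
  show "is_arg_max (\<lambda>f. \<bar>frob_inner (edge_mat f) (R i)\<bar>) (\<lambda>f. f \<in> E) (e (Suc i))"
    by (rule step[THEN conjunct1])
  show "is_arg_min
      (\<lambda>(s, t). (frob_norm (laplacian E w - s *\<^sub>R H i - t *\<^sub>R edge_mat (e (Suc i))))\<^sup>2)
      (\<lambda>_. True) (a (Suc i))"
    by (rule step[THEN conjunct2, THEN conjunct1])
  show "H (Suc i) = fst (a (Suc i)) *\<^sub>R H i + snd (a (Suc i)) *\<^sub>R edge_mat (e (Suc i))"
    by (rule step[THEN conjunct2, THEN conjunct2, THEN conjunct1])
qed

lemma uga_max_edge:
  assumes "f \<in> E"
  shows "\<bar>edge_mat f \<bullet> R i\<bar> \<le> \<bar>edge_mat (e (Suc i)) \<bullet> R i\<bar>"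
  using uga_arg_max[of i] assms by (simp add: is_arg_max_linorder frob_inner_eq_inner)

lemma uga_optimal:
  "(norm (R (Suc i)))\<^sup>2 \<le>
    (norm (laplacian E w - s *\<^sub>R H i - t *\<^sub>R edge_mat (e (Suc i))))\<^sup>2"
proof -
  have "R (Suc i) = laplacian E w - fst (a (Suc i)) *\<^sub>R H i - snd (a (Suc i)) *\<^sub>R edge_mat (e (Suc i))"
    by (simp add: uga_residual uga_approx)
  then show ?thesis
    using uga_arg_min[of i]
    by (simp add: is_arg_min_linorder frob_norm_eq_norm case_prod_beta)
qed

text \<open>Multiples of \<open>H i\<close> stay in the span of \<open>H j\<close> and the selected
  edge matrix, over which step \<open>i = Suc j\<close> minimized; hence moving along
  \<open>H i\<close> cannot shorten \<open>R i\<close>.\<close>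

lemma uga_orthogonal: "H i \<bullet> R i = 0"
proof (cases i)
  case 0
  then show ?thesis using run by (simp add: uga_run_def)
next
  case (Suc j)
  have H: "H i = fst (a i) *\<^sub>R H j + snd (a i) *\<^sub>R edge_mat (e i)"
    by (simp add: Suc uga_approx)
  have "(norm (R i))\<^sup>2 \<le> (norm (R i - t *\<^sub>R H i))\<^sup>2" for t
  proof -
    have "R i - t *\<^sub>R H i = laplacian E w - (1 + t) *\<^sub>R H i"
      by (simp add: uga_residual scaleR_left_distrib)
    also have "\<dots> = laplacian E w - ((1 + t) * fst (a i)) *\<^sub>R H j -
        ((1 + t) * snd (a i)) *\<^sub>R edge_mat (e i)"
      unfolding H by (simp add: scaleR_right_distrib)
    finally show ?thesis
      using uga_optimal[of j] Suc by simp
  qed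
  then show ?thesis by (rule inner_zero_if_norm_min)
qed

lemma uga_residual_norm: "(norm (R i))\<^sup>2 = laplacian E w \<bullet> R i"
proof -
  have "laplacian E w = R i + H i" by (simp add: uga_residual)
  then show ?thesis by (simp add: inner_add_left uga_orthogonal power2_norm_eq_inner)
qed

lemma uga_decrease:
  "(edge_mat (e (Suc i)) \<bullet> R i)\<^sup>2 \<le> 4 * ((norm (R i))\<^sup>2 - (norm (R (Suc i)))\<^sup>2)"
proof -
  let ?A = "edge_mat (e (Suc i))"
  \<comment> \<open>The exact line-search minimizer when \<open>?A \<bullet> ?A = 4\<close>; for a
    loop \<open>?A = 0\<close>, hence \<open>t = 0\<close>.\<close>
  define t where "t = ?A \<bullet> R i / 4"
  have "?A \<bullet> ?A \<le> 4"
    by (cases "e (Suc i)" rule: edge_mat_cases) simp_all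
  then have "t\<^sup>2 * (?A \<bullet> ?A) \<le> t\<^sup>2 * 4"
    by (rule mult_left_mono) simp
  have "(norm (R (Suc i)))\<^sup>2 \<le> (norm (R i - t *\<^sub>R ?A))\<^sup>2"
    \<comment> \<open>The coefficient 1 keeps the previous approximation and only adds a multiple of
      the new edge.\<close>
    using uga_optimal[of i 1 t] by (simp add: uga_residual[of i])
  also have "\<dots> = (norm (R i))\<^sup>2 - 2 * t * (?A \<bullet> R i) + t\<^sup>2 * (?A \<bullet> ?A)"
    by (rule power2_norm_diff_scaleR)
  also have "\<dots> \<le> (norm (R i))\<^sup>2 - 2 * t * (?A \<bullet> R i) + t\<^sup>2 * 4"
    using \<open>t\<^sup>2 * (?A \<bullet> ?A) \<le> t\<^sup>2 * 4\<close> by simp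
  also have "\<dots> = (norm (R i))\<^sup>2 - (?A \<bullet> R i)\<^sup>2 / 4"
    by (simp add: t_def field_simps power2_eq_square)
  finally show ?thesis by simp
qed

lemma uga_antimono: "(norm (R (Suc i)))\<^sup>2 \<le> (norm (R i))\<^sup>2"
proof -
  have "0 \<le> 4 * ((norm (R i))\<^sup>2 - (norm (R (Suc i)))\<^sup>2)"
    using uga_decrease[of i] by (rule order_trans[rotated]) simp
  then show ?thesis by simp
qed

lemma uga_recurrence:
  assumes w: "\<And>f. f \<in> E \<Longrightarrow> 0 \<le> w f"
  shows "((norm (R i))\<^sup>2)\<^sup>2 \<le>
    (trace (laplacian E w))\<^sup>2 * ((norm (R i))\<^sup>2 - (norm (R (Suc i)))\<^sup>2)"
proof -
  let ?T = "trace (laplacian E w)" and ?M = "edge_mat (e (Suc i)) \<bullet> R i"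
  have "(norm (R i))\<^sup>2 \<le> ?T / 2 * \<bar>?M\<bar>"
    unfolding uga_residual_norm by (rule inner_laplacian_le[OF w uga_max_edge])
  then have "((norm (R i))\<^sup>2)\<^sup>2 \<le> (?T / 2 * \<bar>?M\<bar>)\<^sup>2"
    by (rule power_mono) simp
  \<comment> \<open>Squaring the half of the trace produces exactly the \<open>1 / 4\<close> that
    absorbs the factor 4 of \<open>uga_decrease\<close>.\<close>
  also have "\<dots> = ?T\<^sup>2 * (?M\<^sup>2 / 4)"
    by (simp add: power_mult_distrib power_divide)
  also have "\<dots> \<le> ?T\<^sup>2 * ((norm (R i))\<^sup>2 - (norm (R (Suc i)))\<^sup>2)"
    using uga_decrease[of i] by (intro mult_left_mono) simp_all
  finally show ?thesis .
qed

end

theorem theorem3p12: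
  fixes E :: "'n::finite uprod set" and w :: "'n uprod \<Rightarrow> real"
    and e :: "nat \<Rightarrow> 'n uprod" and a :: "nat \<Rightarrow> real \<times> real"
    and H R :: "nat \<Rightarrow> real^'n^'n" and i :: nat
  assumes "\<And>f. f \<in> E \<Longrightarrow> 0 < w f"
    and "uga_run E w e a H R"
    and "i \<ge> 1"
  shows "(frob_norm (R (i + 1)))\<^sup>2 \<le>
    (frob_norm (laplacian E w))\<^sup>2 /
      (1 + real i * (frob_norm (laplacian E w))\<^sup>2 / (trace (laplacian E w))\<^sup>2)"
proof -
  \<comment> \<open>Decay from index 0 bounds \<open>R i\<close> with the factor \<open>i\<close>;
    monotonicity carries this bound to index \<open>i + 1\<close>.\<close>
  have "(norm (R (Suc i)))\<^sup>2 \<le> (norm (R i))\<^sup>2"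
    using assms(2) by (rule uga_antimono)
  also have "(norm (R i))\<^sup>2 \<le> (norm (R 0))\<^sup>2 / (1 + real i * (norm (R 0))\<^sup>2 / (trace (laplacian E w))\<^sup>2)"
    by (rule sublinear_decay[where r = "\<lambda>i. (norm (R i))\<^sup>2"])
      (use uga_recurrence[OF assms(2) less_imp_le[OF assms(1)]] in \<open>simp_all only: zero_le_power2\<close>)
  also have "R 0 = laplacian E w"
    using assms(2) by (simp add: uga_run_def)
  finally show ?thesis
    by (simp only: frob_norm_eq_norm Suc_eq_plus1)
qed

end
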